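(* Consider a mechanical system with $N$ degrees of freedom whose parameters and/or initial states are uncertain, the uncertainty being described by the random vector $\xi$. Let $L=L(q,v;\xi)$ be its Lagrangian, let $F=(F_1,\dots,F_N)^\top$ with $F_i=F_i(q,v,u;\xi)$ be the set of non-conservative forces ($u$ being the deterministic control input), and let its equations of motion be $$v_i=\dot q_i,\qquad p_i=\frac{\partial L}{\partial v_i},\qquad \dot p_i=\frac{\partial L}{\partial q_i}+F_i,\qquad i=1,\dots,N.$$ Suppose that position, velocity and momentum are expanded as $$q_i(t,\xi)=\sum_{j=0}^K q_{ij}(t)\phi_j(\xi),\quad v_i(t,\xi)=\sum_{j=0}^K v_{ij}(t)\phi_j(\xi),\quad p_i(t,\xi)=\sum_{j=0}^K p_{ij}(t)\phi_j(\xi),$$ where the coefficients are governed by the Galerkin projection of the equations of motion. Let $\mathbf Q=(q_{ij})$, $\mathbf V=(v_{ij})$, $\hat{\mathbf P}=(\hat p_{ij})$ with $\hat p_{ij}=p_{ij}\langle\phi_j,\phi_j\rangle$, where $i=1,\dots,N$ and $j=0,\dots,K$. Define $$\hat L(\mathbf Q,\mathbf V)=\int_{\mathcal D}L\,\rho(\xi)\,\mathrm d\xi,\qquad \hat F_{ij}(\mathbf Q,\mathbf V,u)=\int_{\mathcal D}F_i\,\phi_j(\xi)\rho(\xi)\,\mathrm d\xi,$$ where $L$ and $F_i$ are evaluated at $q=(q_1,\dots,q_N)^\top$ and $v=(v_1,\dots,v_N)^\top$ with $q_m=\sum_{l=0}^K q_{ml}\phi_l(\xi)$ and $v_m=\sum_{l=0}^K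 v_{ml}\phi_l(\xi)$, $m=1,\dots,N$. Then the system of coefficients $(\mathbf Q,\mathbf V,\hat{\mathbf P})$ satisfies the same form of equations of motion, with Lagrangian $\hat L$ and non-conservative forces $\hat{\mathbf F}=(\hat F_{ij})$; that is, for all $i=1,\dots,N$ and $j=0,\dots,K$, $$v_{ij}=\dot q_{ij},\qquad \hat p_{ij}=\frac{\partial\hat L}{\partial v_{ij}},\qquad \dot{\hat p}_{ij}=\frac{\partial\hat L}{\partial q_{ij}}+\hat F_{ij}.$$
   Context: Generalized Polynomial Chaos (gPC): $\xi\in\mathbb R^d$ is a random vector with mutually independent components, support $\mathcal D$ and density $\rho$. The polynomials $\phi_0,\dots,\phi_K$ are real polynomials in $\xi$ that are orthogonal with respect to $\rho$: $\langle\phi_i,\phi_j\rangle:=\int_{\mathcal D}\phi_i\phi_j\rho\,\mathrm d\xi=\delta_{ij}\langle\phi_i,\phi_i\rangle$, with $\langle\phi_i,\phi_i\rangle>0$. All random quantities are assumed to belong to $L^2_\rho=\{g:\mathcal D\to\mathbb R:\int_{\mathcal D} g^2\rho\,\mathrm d\xi<\infty\}$. Galerkin projection of the equations of motion: the truncated expansions are substituted into the equations and the residual of each equation is required to be orthogonal (in $L^2_\rho$) to $\mathrm{span}\{\phi_0,\dots,\phi_K\}$. That is, for all $i,j$ and all $t$: $\int_{\mathcal D}(v_i-\dot q_i)\phi_j\rho\,\mathrm d\xi=0$, $\int_{\mathcal D}(p_i-\partial L/\partial v_i)\phi_j\rho\,\mathrm d\xi=0$ and $\int_{\mathcal D}(\dot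 p_i-\partial L/\partial q_i-F_i)\phi_j\rho\,\mathrm d\xi=0$, with all functions evaluated at the expansions. The coefficients are deterministic functions of time. The functions involved are assumed regular enough that the integrals are well defined and can be differentiated under the integral sign with respect to the deterministic gPC coefficients. *)

theory Defs
  imports "HOL-Probability.Probability"
begin

definition support_of :: "'a::topological_space measure \<Rightarrow> 'a set" where
  "support_of \<mu> = {x. \<forall>U. open U \<and> x \<in> U \<longrightarrow> emeasure \<mu> U > 0}"

definition rho_integral ::
    "(real ^ 'd) set \<Rightarrow> (real ^ 'd \<Rightarrow> real) \<Rightarrow> (real ^ 'd \<Rightarrow> real) \<Rightarrow> real" where
  "rho_integral D \<rho> g = (LINT x:D|lborel. g x * \<rho> x)"

definition rho_integrable ::
    "(real ^ 'd) set \<Rightarrow> (real ^ 'd \<Rightarrow> real) \<Rightarrow> (real ^ 'd \<Rightarrow> real) \<Rightarrow> bool" where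
  "rho_integrable D \<rho> g \<longleftrightarrow> set_integrable lborel D (\<lambda>x. g x * \<rho> x)"

definition rho_inner ::
    "(real ^ 'd) set \<Rightarrow> (real ^ 'd \<Rightarrow> real) \<Rightarrow> (real ^ 'd \<Rightarrow> real) \<Rightarrow> (real ^ 'd \<Rightarrow> real) \<Rightarrow> real"
  where "rho_inner D \<rho> f g = rho_integral D \<rho> (\<lambda>x. f x * g x)"

definition L2_rho :: "(real ^ 'd) set \<Rightarrow> (real ^ 'd \<Rightarrow> real) \<Rightarrow> (real ^ 'd \<Rightarrow> real) set" where
  "L2_rho D \<rho> = {g. set_borel_measurable lborel D g \<and> rho_integrable D \<rho> (\<lambda>x. (g x)\<^sup>2)}"

definition partially_differentiable ::
    "('a::real_normed_vector \<Rightarrow> real) \<Rightarrow> 'a \<Rightarrow> 'a \<Rightarrow> bool" where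
  "partially_differentiable f e a \<longleftrightarrow>
     (\<lambda>s. f (a + s *\<^sub>R e)) differentiable (at (0::real))"

(* Meaningful only together with partially_differentiable; e is a coordinate vector. *)
definition partial_deriv :: "('a::real_normed_vector \<Rightarrow> real) \<Rightarrow> 'a \<Rightarrow> 'a \<Rightarrow> real" where
  "partial_deriv f e a = deriv (\<lambda>s. f (a + s *\<^sub>R e)) (0::real)"

abbreviation unit_vec :: "'n::finite \<Rightarrow> real ^ 'n" where
  "unit_vec i \<equiv> axis i 1"

(* The coordinate direction of the entry (i, j) of a coefficient matrix, whose rows are
   the degrees of freedom and whose columns are the basis polynomials. *)
abbreviation unit_mat :: "'n::finite \<Rightarrow> 'k::finite \<Rightarrow> real ^ 'k ^ 'n" where
  "unit_mat i j \<equiv> axis i (axis j 1)"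

(* The integrand is differentiated as a function of the deterministic parameter a (in the
   application: the coefficient matrix), in the coordinate direction e. *)
definition diff_under_rho_integral ::
    "(real ^ 'd) set \<Rightarrow> (real ^ 'd \<Rightarrow> real) \<Rightarrow> ('a::real_normed_vector \<Rightarrow> real ^ 'd \<Rightarrow> real)
      \<Rightarrow> 'a \<Rightarrow> 'a \<Rightarrow> bool" where
  "diff_under_rho_integral D \<rho> g e a \<longleftrightarrow>
     (\<forall>\<^sub>F s in nhds (0::real). rho_integrable D \<rho> (g (a + s *\<^sub>R e))) \<and>
     (\<forall>x\<in>D. partially_differentiable (\<lambda>b. g b x) e a) \<and>
     rho_integrable D \<rho> (\<lambda>x. partial_deriv (\<lambda>b. g b x) e a) \<and>
     partially_differentiable (\<lambda>b. rho_integral D \<rho> (g b)) e a \<and>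
     partial_deriv (\<lambda>b. rho_integral D \<rho> (g b)) e a =
       rho_integral D \<rho> (\<lambda>x. partial_deriv (\<lambda>b. g b x) e a)"

definition gpc_expand ::
    "('k::finite \<Rightarrow> real ^ 'd \<Rightarrow> real) \<Rightarrow> real ^ 'k ^ 'n \<Rightarrow> real ^ 'd \<Rightarrow> real ^ 'n" where
  "gpc_expand \<phi> A x = (\<chi> m. \<Sum>l\<in>UNIV. A $ m $ l * \<phi> l x)"

definition gpc_lagrangian ::
    "(real ^ 'd) set \<Rightarrow> (real ^ 'd \<Rightarrow> real) \<Rightarrow> ('k::finite \<Rightarrow> real ^ 'd \<Rightarrow> real)
      \<Rightarrow> (real ^ 'n \<Rightarrow> real ^ 'n \<Rightarrow> real ^ 'd \<Rightarrow> real)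
      \<Rightarrow> real ^ 'k ^ 'n \<Rightarrow> real ^ 'k ^ 'n \<Rightarrow> real" where
  "gpc_lagrangian D \<rho> \<phi> L Q V =
     rho_integral D \<rho> (\<lambda>x. L (gpc_expand \<phi> Q x) (gpc_expand \<phi> V x) x)"

definition gpc_force ::
    "(real ^ 'd) set \<Rightarrow> (real ^ 'd \<Rightarrow> real) \<Rightarrow> ('k::finite \<Rightarrow> real ^ 'd \<Rightarrow> real)
      \<Rightarrow> (real ^ 'n \<Rightarrow> real ^ 'n \<Rightarrow> 'u \<Rightarrow> real ^ 'd \<Rightarrow> real ^ 'n)
      \<Rightarrow> real ^ 'k ^ 'n \<Rightarrow> real ^ 'k ^ 'n \<Rightarrow> 'u \<Rightarrow> real ^ 'k ^ 'n" where
  "gpc_force D \<rho> \<phi> F Q V w =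
     (\<chi> i j. rho_integral D \<rho>
        (\<lambda>x. F (gpc_expand \<phi> Q x) (gpc_expand \<phi> V x) w x $ i * \<phi> j x))"

definition gpc_momentum ::
    "(real ^ 'd) set \<Rightarrow> (real ^ 'd \<Rightarrow> real) \<Rightarrow> ('k::finite \<Rightarrow> real ^ 'd \<Rightarrow> real)
      \<Rightarrow> real ^ 'k ^ 'n \<Rightarrow> real ^ 'k ^ 'n" where
  "gpc_momentum D \<rho> \<phi> P = (\<chi> i j. P $ i $ j * rho_inner D \<rho> (\<phi> j) (\<phi> j))"

(* The time derivatives are those of the expansions at fixed x; vector_derivative is
   meaningful here only for differentiable coefficients Q, P and a nondegenerate interval T. *)
definition galerkin_projected ::
    "real set \<Rightarrow> (real ^ 'd) set \<Rightarrow> (real ^ 'd \<Rightarrow> real) \<Rightarrow> ('k::finite \<Rightarrow> real ^ 'd \<Rightarrow> real)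
      \<Rightarrow> (real ^ 'n \<Rightarrow> real ^ 'n \<Rightarrow> real ^ 'd \<Rightarrow> real)
      \<Rightarrow> (real ^ 'n \<Rightarrow> real ^ 'n \<Rightarrow> 'u \<Rightarrow> real ^ 'd \<Rightarrow> real ^ 'n)
      \<Rightarrow> (real \<Rightarrow> 'u) \<Rightarrow> (real \<Rightarrow> real ^ 'k ^ 'n) \<Rightarrow> (real \<Rightarrow> real ^ 'k ^ 'n)
      \<Rightarrow> (real \<Rightarrow> real ^ 'k ^ 'n) \<Rightarrow> bool" where
  "galerkin_projected T D \<rho> \<phi> L F u Q V P \<longleftrightarrow>
     (let q = (\<lambda>t. gpc_expand \<phi> (Q t)); v = (\<lambda>t. gpc_expand \<phi> (V t)); p = (\<lambda>t. gpc_expand \<phi> (P t)) in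
      \<forall>t\<in>T. \<forall>i j.
        rho_inner D \<rho>
          (\<lambda>x. v t x $ i - vector_derivative (\<lambda>s. q s x $ i) (at t within T)) (\<phi> j) = 0 \<and>
        rho_inner D \<rho>
          (\<lambda>x. p t x $ i - partial_deriv (\<lambda>b. L (q t x) b x) (unit_vec i) (v t x)) (\<phi> j) = 0 \<and>
        rho_inner D \<rho>
          (\<lambda>x. vector_derivative (\<lambda>s. p s x $ i) (at t within T)
               - partial_deriv (\<lambda>a. L a (v t x) x) (unit_vec i) (q t x)
               - F (q t x) (v t x) (u t) x $ i) (\<phi> j) = 0)"

end

theory Submission
  imports Defs
begin

text \<open>
  Testing the Galerkin residuals against \<open>\<phi> j\<close> isolates, by orthogonality, the \<open>j\<close>-th coefficient
  of each expansion, scaled by \<open>\<langle>\<phi> j, \<phi> j\<rangle>\<close>. On the other side, the \<open>(i, j)\<close> entry of a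
  coefficient matrix enters the Lagrangian only through the \<open>i\<close>-th coordinate and with factor
  \<open>\<phi> j\<close>, so by the chain rule and differentiation under the integral sign the projection of
  \<open>\<partial>L/\<partial>q\<^sub>i\<close> (or \<open>\<partial>L/\<partial>v\<^sub>i\<close>) on \<open>\<phi> j\<close> is the partial derivative of the averaged Lagrangian.
\<close>

section \<open>Topology of the support and of the time interval\<close>

lemma support_of_closed: "closed (support_of \<mu>)"
proof -
  \<comment> \<open>A point outside the support has an open null neighbourhood, and every point of
    an open null set is outside.\<close>
  have "- support_of \<mu> = \<Union> {U. open U \<and> emeasure \<mu> U = 0}"
    unfolding support_of_def by (auto simp: not_gr_zero)
  then have "open (- support_of \<mu>)"
    by auto
  then show ?thesis
    by (simp add: closed_def)
qed

text \<open>A connected set with more than one point has no isolated points. This makes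
  \<open>vector_derivative\<close> within \<open>T\<close> well determined at every time, endpoints
  included.\<close>

lemma at_within_interval_neq_bot:
  fixes T :: "real set"
  assumes "is_interval T" "interior T \<noteq> {}" "t \<in> T"
  shows "at t within T \<noteq> bot"
proof -
  have "T \<noteq> {a}" for a
    using assms(2) by auto
  then show ?thesis
    using connected_imp_perfect[of T t] assms is_interval_connected_1[of T]
    by (auto simp: trivial_limit_within)
qed

section \<open>Partial derivatives with respect to the coefficients\<close>

lemma partially_differentiable_has_derivative:
  assumes "partially_differentiable f e a"
  shows "((\<lambda>s. f (a + s *\<^sub>R e)) has_real_derivative partial_deriv f e a) (at 0)"
  using assms unfolding partially_differentiable_def partial_deriv_def
  by (simp add: DERIV_deriv_iff_real_differentiable)

lemma gpc_expand_nth: "gpc_expand \<phi> A x $ i = (\<Sum>l\<in>UNIV. A $ i $ l * \<phi> l x)"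
  by (simp add: gpc_expand_def)

text \<open>The expansion is linear in its coefficients, and \<open>unit_mat i j\<close> expands to
  \<open>\<phi> j x\<close> times \<open>unit_vec i\<close>. Varying one coefficient thus moves the
  expansion along a single coordinate line.\<close>

lemma gpc_expand_add_unit_mat:
  "gpc_expand \<phi> (A + s *\<^sub>R unit_mat i j) x = gpc_expand \<phi> A x + (s * \<phi> j x) *\<^sub>R unit_vec i"
proof (subst vec_eq_iff, intro allI)
  fix m
  have "(s *\<^sub>R unit_mat i j :: real^_^_) $ m $ l * \<phi> l x
      = (if l = j then s * \<phi> j x * of_bool (m = i) else 0)" for l
    by (auto simp: axis_def)
  then show "gpc_expand \<phi> (A + s *\<^sub>R unit_mat i j) x $ m
      = (gpc_expand \<phi> A x + (s * \<phi> j x) *\<^sub>R unit_vec i) $ m"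
    by (simp add: gpc_expand_nth distrib_right sum.distrib del: vector_scaleR_component)
       (auto simp: axis_def)
qed

text \<open>At fixed \<open>x\<close> the expansion travels along its \<open>i\<close>-th coordinate
  line at constant speed \<open>\<phi> j x\<close>, so the chain rule in one variable applies and
  differentiability along that line suffices.\<close>

lemma partial_deriv_gpc_expand:
  assumes "partially_differentiable f (unit_vec i) (gpc_expand \<phi> A x)"
  shows "partial_deriv (\<lambda>B. f (gpc_expand \<phi> B x)) (unit_mat i j) A
    = partial_deriv f (unit_vec i) (gpc_expand \<phi> A x) * \<phi> j x"
proof -
  have "((\<lambda>s. f (gpc_expand \<phi> A x + (s * \<phi> j x) *\<^sub>R unit_vec i)) has_real_derivative
      partial_deriv f (unit_vec i) (gpc_expand \<phi> A x) * \<phi> j x) (at 0)"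
    by (rule DERIV_chain2[where g = "\<lambda>s. s * \<phi> j x" and f = "\<lambda>r. f (gpc_expand \<phi> A x + r *\<^sub>R unit_vec i)"])
       (use partially_differentiable_has_derivative[OF assms]
        in \<open>auto intro!: derivative_eq_intros\<close>)
  then show ?thesis
    unfolding partial_deriv_def[of "\<lambda>B. f (gpc_expand \<phi> B x)"] gpc_expand_add_unit_mat
    by (rule DERIV_imp_deriv)
qed

section \<open>Time derivatives of the expansions\<close>

lemma has_real_derivative_nth_nth:
  fixes A :: "real \<Rightarrow> real ^ 'k ^ 'n"
  assumes "(A has_vector_derivative A') (at t within T)"
  shows "((\<lambda>s. A s $ i $ j) has_real_derivative A' $ i $ j) (at t within T)"
proof -
  have "bounded_linear (\<lambda>B :: real ^ 'k ^ 'n. B $ i $ j)"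
    by (intro bounded_linear_compose[OF bounded_linear_vec_nth bounded_linear_vec_nth])
  from bounded_linear.has_vector_derivative[OF this assms] show ?thesis
    by (simp add: has_real_derivative_iff_has_vector_derivative)
qed

text \<open>The finite sum is differentiated termwise; nontriviality of the filter makes the
  derivative unique, so that \<open>vector_derivative\<close> equals it.\<close>

lemma vector_derivative_gpc_expand:
  assumes "(A has_vector_derivative A') (at t within T)" "at t within T \<noteq> bot"
  shows "vector_derivative (\<lambda>s. gpc_expand \<phi> (A s) x $ i) (at t within T)
    = gpc_expand \<phi> A' x $ i"
proof (rule vector_derivative_within[OF assms(2)])
  have "((\<lambda>s. \<Sum>l\<in>UNIV. A s $ i $ l * \<phi> l x) has_real_derivative
      (\<Sum>l\<in>UNIV. A' $ i $ l * \<phi> l x)) (at t within T)"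
    by (intro DERIV_sum DERIV_cmult_right has_real_derivative_nth_nth[OF assms(1)])
  then show "((\<lambda>s. gpc_expand \<phi> (A s) x $ i) has_vector_derivative gpc_expand \<phi> A' x $ i)
      (at t within T)"
    by (simp add: gpc_expand_nth has_real_derivative_iff_has_vector_derivative)
qed

section \<open>Integration with respect to the weight\<close>

lemma rho_integrable_mult_L2:
  assumes \<rho>: "\<rho> \<in> borel_measurable borel" "\<And>x. 0 \<le> \<rho> x"
    and D: "D \<in> sets borel"
    and f: "f \<in> L2_rho D \<rho>" and g: "g \<in> L2_rho D \<rho>"
  shows "rho_integrable D \<rho> (\<lambda>x. f x * g x)"
proof -
  have int: "integrable lborel (\<lambda>x. indicator D x *\<^sub>R ((f x)\<^sup>2 * \<rho> x))"
      "integrable lborel (\<lambda>x. indicator D x *\<^sub>R ((g x)\<^sup>2 * \<rho> x))"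
    and meas: "(\<lambda>x. indicator D x *\<^sub>R f x) \<in> borel_measurable borel"
      "(\<lambda>x. indicator D x *\<^sub>R g x) \<in> borel_measurable borel"
    using f g by (auto simp: L2_rho_def rho_integrable_def set_integrable_def
        set_borel_measurable_def)
  \<comment> \<open>Membership in \<open>L2_rho\<close> gives measurability only of the functions
    cut off to \<open>D\<close>, so both factors are cut off; idempotence of the indicator merges
    the two cut-offs.\<close>
  have "(\<lambda>x. (indicator D x *\<^sub>R f x) * (indicator D x *\<^sub>R g x) * \<rho> x) \<in> borel_measurable borel"
    using meas \<rho>(1) by measurable
  moreover have "(\<lambda>x. (indicator D x *\<^sub>R f x) * (indicator D x *\<^sub>R g x) * \<rho> x)
      = (\<lambda>x. indicator D x *\<^sub>R (f x * g x * \<rho> x))"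
    by (auto simp: indicator_def)
  ultimately have meas_fg: "(\<lambda>x. indicator D x *\<^sub>R (f x * g x * \<rho> x)) \<in> borel_measurable lborel"
    by simp
  \<comment> \<open>Pointwise domination by the two integrable squares takes the place of the
    Cauchy-Schwarz inequality; the factor 1/2 is dropped.\<close>
  have "\<bar>f x * g x * \<rho> x\<bar> \<le> (f x)\<^sup>2 * \<rho> x + (g x)\<^sup>2 * \<rho> x" for x
  proof -
    have "\<bar>f x * g x\<bar> \<le> (f x)\<^sup>2 + (g x)\<^sup>2"
      using sum_squares_bound[of "\<bar>f x\<bar>" "\<bar>g x\<bar>"] abs_ge_zero[of "f x * g x"]
      unfolding abs_mult power2_abs by linarith
    from mult_right_mono[OF this \<rho>(2)] show ?thesis
      using \<rho>(2)[of x] by (simp add: abs_mult algebra_simps)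
  qed
  then have "norm (indicator D x *\<^sub>R (f x * g x * \<rho> x))
      \<le> norm (indicator D x *\<^sub>R ((f x)\<^sup>2 * \<rho> x) + indicator D x *\<^sub>R ((g x)\<^sup>2 * \<rho> x))" for x
    using \<rho>(2)[of x] by (auto simp: indicator_def)
  then show ?thesis
    unfolding rho_integrable_def set_integrable_def
    by (intro Bochner_Integration.integrable_bound[OF Bochner_Integration.integrable_add[OF int] meas_fg] AE_I2)
qed

lemma rho_integral_cong:
  assumes "\<And>x. x \<in> D \<Longrightarrow> f x = g x"
  shows "rho_integral D \<rho> f = rho_integral D \<rho> g"
  unfolding rho_integral_def set_lebesgue_integral_def
  by (rule Bochner_Integration.integral_cong) (auto simp: indicator_def assms)

lemma rho_integral_add:
  assumes "rho_integrable D \<rho> f" "rho_integrable D \<rho> g"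
  shows "rho_integrable D \<rho> (\<lambda>x. f x + g x)"
    and "rho_integral D \<rho> (\<lambda>x. f x + g x) = rho_integral D \<rho> f + rho_integral D \<rho> g"
  using set_integral_add[OF assms[unfolded rho_integrable_def]]
  by (simp_all add: rho_integrable_def rho_integral_def distrib_right)

lemma rho_integral_diff:
  assumes "rho_integrable D \<rho> f" "rho_integrable D \<rho> g"
  shows "rho_integral D \<rho> (\<lambda>x. f x - g x) = rho_integral D \<rho> f - rho_integral D \<rho> g"
  using set_integral_diff(2)[OF assms[unfolded rho_integrable_def]]
  by (simp add: rho_integral_def left_diff_distrib)

lemma rho_integral_sum_cmult:
  assumes "finite I" "\<And>l. l \<in> I \<Longrightarrow> rho_integrable D \<rho> (f l)"
  shows "rho_integrable D \<rho> (\<lambda>x. \<Sum>l\<in>I. c l * f l x)"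
    and "rho_integral D \<rho> (\<lambda>x. \<Sum>l\<in>I. c l * f l x) = (\<Sum>l\<in>I. c l * rho_integral D \<rho> (f l))"
proof -
  have *: "integrable lborel (\<lambda>x. c l * (indicator D x *\<^sub>R (f l x * \<rho> x)))" if "l \<in> I" for l
    using assms(2)[OF that] by (simp add: rho_integrable_def set_integrable_def)
  have eq: "(\<lambda>x. indicator D x *\<^sub>R ((\<Sum>l\<in>I. c l * f l x) * \<rho> x))
      = (\<lambda>x. \<Sum>l\<in>I. c l * (indicator D x *\<^sub>R (f l x * \<rho> x)))"
    by (auto simp: sum_distrib_left sum_distrib_right algebra_simps)
  show "rho_integrable D \<rho> (\<lambda>x. \<Sum>l\<in>I. c l * f l x)"
    unfolding rho_integrable_def set_integrable_def eq
    by (rule Bochner_Integration.integrable_sum[OF *])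
  show "rho_integral D \<rho> (\<lambda>x. \<Sum>l\<in>I. c l * f l x) = (\<Sum>l\<in>I. c l * rho_integral D \<rho> (f l))"
    unfolding rho_integral_def set_lebesgue_integral_def eq
    using * by (subst Bochner_Integration.integral_sum) auto
qed

section \<open>Projection of expansions onto the basis\<close>

lemma rho_integral_gpc_expand_mult:
  fixes \<phi> :: "'k::finite \<Rightarrow> real ^ 'd \<Rightarrow> real"
  assumes "\<And>l. rho_integrable D \<rho> (\<lambda>x. \<phi> l x * h x)"
  shows "rho_integrable D \<rho> (\<lambda>x. gpc_expand \<phi> A x $ i * h x)"
    and "rho_integral D \<rho> (\<lambda>x. gpc_expand \<phi> A x $ i * h x)
      = (\<Sum>l\<in>UNIV. A $ i $ l * rho_integral D \<rho> (\<lambda>x. \<phi> l x * h x))"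
  using rho_integral_sum_cmult[where I = "UNIV :: 'k set" and c = "\<lambda>l. A $ i $ l", OF finite assms]
  by (simp_all add: gpc_expand_nth sum_distrib_right mult.assoc)

text \<open>The residual condition says that \<open>g\<close> and the expansion have the same inner
  product with \<open>\<phi> j\<close>, and orthogonality leaves only the \<open>j\<close>-th term
  of the latter. Leaving \<open>A\<close> and \<open>g\<close> arbitrary lets one fact serve all
  three equations of motion.\<close>

lemma galerkin_residual_coefficient:
  fixes \<phi> :: "'k::finite \<Rightarrow> real ^ 'd \<Rightarrow> real"
  assumes integrable: "\<And>l. rho_integrable D \<rho> (\<lambda>x. \<phi> l x * \<phi> j x)"
    and orthogonal: "\<And>l. l \<noteq> j \<Longrightarrow> rho_inner D \<rho> (\<phi> l) (\<phi> j) = 0"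
    and g: "rho_integrable D \<rho> (\<lambda>x. g x * \<phi> j x)"
    and residual: "rho_inner D \<rho> (\<lambda>x. gpc_expand \<phi> A x $ i - g x) (\<phi> j) = 0"
  shows "A $ i $ j * rho_inner D \<rho> (\<phi> j) (\<phi> j) = rho_inner D \<rho> g (\<phi> j)"
proof -
  have "rho_inner D \<rho> g (\<phi> j) = rho_inner D \<rho> (\<lambda>x. gpc_expand \<phi> A x $ i) (\<phi> j)"
    using residual rho_integral_diff[OF rho_integral_gpc_expand_mult(1)[where \<phi> = \<phi> and A = A and i = i, OF integrable] g]
    by (simp add: rho_inner_def left_diff_distrib)
  also have "\<dots> = (\<Sum>l\<in>UNIV. A $ i $ l * rho_inner D \<rho> (\<phi> l) (\<phi> j))"
    unfolding rho_inner_def by (rule rho_integral_gpc_expand_mult(2)[OF integrable])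
  also have "\<dots> = (\<Sum>l\<in>UNIV. if l = j then A $ i $ j * rho_inner D \<rho> (\<phi> j) (\<phi> j) else 0)"
    by (intro sum.cong) (auto simp: orthogonal)
  finally show ?thesis
    by simp
qed

text \<open>Under the integral sign the chain rule produces the factor \<open>\<phi> j\<close>,
  which turns the integral into a projection. Since \<open>f\<close> may depend on \<open>x\<close>,
  the other argument of the Lagrangian can be frozen inside it, which covers positions and
  velocities alike.\<close>

lemma partial_deriv_rho_integral_gpc_expand:
  assumes "diff_under_rho_integral D \<rho> (\<lambda>A x. f (gpc_expand \<phi> A x) x) (unit_mat i j) A"
    and "\<And>x. x \<in> D \<Longrightarrow>
      partially_differentiable (\<lambda>a. f a x) (unit_vec i) (gpc_expand \<phi> A x)"
  shows "partially_differentiable (\<lambda>A. rho_integral D \<rho> (\<lambda>x. f (gpc_expand \<phi> A x) x))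
      (unit_mat i j) A"
    and "partial_deriv (\<lambda>A. rho_integral D \<rho> (\<lambda>x. f (gpc_expand \<phi> A x) x)) (unit_mat i j) A
      = rho_inner D \<rho>
          (\<lambda>x. partial_deriv (\<lambda>a. f a x) (unit_vec i) (gpc_expand \<phi> A x)) (\<phi> j)"
  using assms(1) rho_integral_cong[of D, OF partial_deriv_gpc_expand[OF assms(2)]]
  by (simp_all add: diff_under_rho_integral_def rho_inner_def)

section \<open>Equations of motion of the coefficients\<close>

theorem mainTheorem1:
  fixes M :: "'w measure"
    and \<xi> :: "'w \<Rightarrow> real ^ 'd"
    and \<rho> :: "real ^ 'd \<Rightarrow> real"
    and D :: "(real ^ 'd) set"
    and \<phi> :: "'k::finite \<Rightarrow> real ^ 'd \<Rightarrow> real"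
    and L :: "real ^ 'n \<Rightarrow> real ^ 'n \<Rightarrow> real ^ 'd \<Rightarrow> real"
    and F :: "real ^ 'n \<Rightarrow> real ^ 'n \<Rightarrow> 'u \<Rightarrow> real ^ 'd \<Rightarrow> real ^ 'n"
    and u :: "real \<Rightarrow> 'u"
    and T :: "real set"
    and Q V P Phat :: "real \<Rightarrow> real ^ 'k ^ 'n"
    and Lhat :: "real ^ 'k ^ 'n \<Rightarrow> real ^ 'k ^ 'n \<Rightarrow> real"
    and Fhat :: "real ^ 'k ^ 'n \<Rightarrow> real ^ 'k ^ 'n \<Rightarrow> 'u \<Rightarrow> real ^ 'k ^ 'n"
    and q v :: "real \<Rightarrow> real ^ 'd \<Rightarrow> real ^ 'n"
  assumes prob: "prob_space M"
    and indep: "prob_space.indep_vars M (\<lambda>_. borel) (\<lambda>c w. \<xi> w $ c) UNIV"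
    and density: "distributed M lborel \<xi> (\<lambda>x. ennreal (\<rho> x))" "\<And>x. \<rho> x \<ge> 0"
    and support: "D = support_of (distr M borel \<xi>)"
    and phi_polynomial: "\<And>j. real_polynomial_function (\<phi> j)"
    and phi_L2: "\<And>j. \<phi> j \<in> L2_rho D \<rho>"
    and phi_orthogonal: "\<And>i j. i \<noteq> j \<Longrightarrow> rho_inner D \<rho> (\<phi> i) (\<phi> j) = 0"
    and phi_positive: "\<And>j. rho_inner D \<rho> (\<phi> j) (\<phi> j) > 0"
    and time_interval: "is_interval T" "interior T \<noteq> {}"
    and Q_differentiable: "Q differentiable_on T"
    and P_differentiable: "P differentiable_on T"
    and q_def: "q = (\<lambda>t. gpc_expand \<phi> (Q t))"
    and v_def: "v = (\<lambda>t. gpc_expand \<phi> (V t))"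
    and L_partial_q: "\<And>t i x. t \<in> T \<Longrightarrow> x \<in> D \<Longrightarrow>
          partially_differentiable (\<lambda>a. L a (v t x) x) (unit_vec i) (q t x)"
    and L_partial_v: "\<And>t i x. t \<in> T \<Longrightarrow> x \<in> D \<Longrightarrow>
          partially_differentiable (\<lambda>b. L (q t x) b x) (unit_vec i) (v t x)"
    and L_partial_q_L2: "\<And>t i. t \<in> T \<Longrightarrow>
          (\<lambda>x. partial_deriv (\<lambda>a. L a (v t x) x) (unit_vec i) (q t x)) \<in> L2_rho D \<rho>"
    and L_partial_v_L2: "\<And>t i. t \<in> T \<Longrightarrow>
          (\<lambda>x. partial_deriv (\<lambda>b. L (q t x) b x) (unit_vec i) (v t x)) \<in> L2_rho D \<rho>"
    and F_L2: "\<And>t i. t \<in> T \<Longrightarrow> (\<lambda>x. F (q t x) (v t x) (u t) x $ i) \<in> L2_rho D \<rho>"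
    and regular_Q: "\<And>t i j. t \<in> T \<Longrightarrow>
          diff_under_rho_integral D \<rho> (\<lambda>A x. L (gpc_expand \<phi> A x) (v t x) x) (unit_mat i j) (Q t)"
    and regular_V: "\<And>t i j. t \<in> T \<Longrightarrow>
          diff_under_rho_integral D \<rho> (\<lambda>B x. L (q t x) (gpc_expand \<phi> B x) x) (unit_mat i j) (V t)"
    and galerkin: "galerkin_projected T D \<rho> \<phi> L F u Q V P"
    and Phat_def: "Phat = (\<lambda>t. gpc_momentum D \<rho> \<phi> (P t))"
    and Lhat_def: "Lhat = gpc_lagrangian D \<rho> \<phi> L"
    and Fhat_def: "Fhat = gpc_force D \<rho> \<phi> F"
  shows "\<forall>t\<in>T. \<forall>i j.
      ((\<lambda>s. Q s $ i $ j) has_real_derivative V t $ i $ j) (at t within T) \<and>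
      partially_differentiable (\<lambda>B. Lhat (Q t) B) (unit_mat i j) (V t) \<and>
      Phat t $ i $ j = partial_deriv (\<lambda>B. Lhat (Q t) B) (unit_mat i j) (V t) \<and>
      partially_differentiable (\<lambda>A. Lhat A (V t)) (unit_mat i j) (Q t) \<and>
      ((\<lambda>s. Phat s $ i $ j) has_real_derivative
         (partial_deriv (\<lambda>A. Lhat A (V t)) (unit_mat i j) (Q t)
          + Fhat (Q t) (V t) (u t) $ i $ j)) (at t within T)"
proof (intro ballI allI)
  fix t i j
  assume t: "t \<in> T"
  note at = at_within_interval_neq_bot[OF time_interval t]
  let ?c = "rho_inner D \<rho> (\<phi> j) (\<phi> j)"
  let ?Lq = "\<lambda>x. partial_deriv (\<lambda>a. L a (v t x) x) (unit_vec i) (q t x)"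
  let ?Lv = "\<lambda>x. partial_deriv (\<lambda>b. L (q t x) b x) (unit_vec i) (v t x)"
  let ?F = "\<lambda>x. F (q t x) (v t x) (u t) x $ i"

  \<comment> \<open>\<open>distributed\<close> gives measurability of the density as an extended
    nonnegative function; nonnegativity of \<open>\<rho>\<close> allows the embedding to be
    undone.\<close>
  have "(\<lambda>x. enn2real (ennreal (\<rho> x))) \<in> borel_measurable borel"
    using distributed_borel_measurable[OF density(1)] by measurable
  then have \<rho>_measurable: "\<rho> \<in> borel_measurable borel"
    by (simp add: density(2))
  have "D \<in> sets borel"
    using support_of_closed support by (metis borel_closed)
  then have int: "rho_integrable D \<rho> (\<lambda>x. f x * \<phi> j x)" if "f \<in> L2_rho D \<rho>" for f
    using rho_integrable_mult_L2[OF \<rho>_measurable density(2)] that phi_L2 by blast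
  have coefficient: "A $ i $ j * ?c = rho_inner D \<rho> g (\<phi> j)"
    if "rho_integrable D \<rho> (\<lambda>x. g x * \<phi> j x)"
      "rho_inner D \<rho> (\<lambda>x. gpc_expand \<phi> A x $ i - g x) (\<phi> j) = 0" for A g
    using galerkin_residual_coefficient[of D \<rho> \<phi> j g A i] int[OF phi_L2] phi_orthogonal that
    by blast

  obtain Q' where Q': "(Q has_vector_derivative Q') (at t within T)"
    using Q_differentiable t unfolding differentiable_on_def by (metis vector_derivative_works)
  obtain P' where P': "(P has_vector_derivative P') (at t within T)"
    using P_differentiable t unfolding differentiable_on_def by (metis vector_derivative_works)

  \<comment> \<open>The time derivatives become expansions with the constant matrices
    \<open>Q'\<close> and \<open>P'\<close>. In the third residual, \<open>?Lq\<close> and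
    \<open>?F\<close> are grouped into one subtrahend to match the form required by
    \<open>coefficient\<close>.\<close>
  have residual_q: "rho_inner D \<rho> (\<lambda>x. gpc_expand \<phi> (V t) x $ i - gpc_expand \<phi> Q' x $ i) (\<phi> j) = 0"
    and residual_p: "rho_inner D \<rho> (\<lambda>x. gpc_expand \<phi> (P t) x $ i - ?Lv x) (\<phi> j) = 0"
    and residual_F: "rho_inner D \<rho> (\<lambda>x. gpc_expand \<phi> P' x $ i - (?Lq x + ?F x)) (\<phi> j) = 0"
    using galerkin[unfolded galerkin_projected_def Let_def, rule_format, OF t, of i j]
    by (simp_all add: q_def v_def diff_diff_eq
        vector_derivative_gpc_expand[OF Q' at] vector_derivative_gpc_expand[OF P' at])

  have Q'_integrable: "rho_integrable D \<rho> (\<lambda>x. gpc_expand \<phi> Q' x $ i * \<phi> j x)"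
    by (rule rho_integral_gpc_expand_mult(1)[OF int[OF phi_L2]])
  from coefficient[OF this residual_q]
  have "V t $ i $ j * ?c = rho_inner D \<rho> (\<lambda>x. gpc_expand \<phi> Q' x $ i) (\<phi> j)" .
  \<comment> \<open>The same extraction is applied with the expansion of \<open>Q'\<close> as its
    own target, where the residual vanishes identically. Positivity of \<open>?c\<close> then
    permits cancellation.\<close>
  also have "\<dots> = Q' $ i $ j * ?c"
    by (rule coefficient[OF Q'_integrable, symmetric])
       (simp add: rho_inner_def rho_integral_def set_lebesgue_integral_def)
  finally have V: "V t $ i $ j = Q' $ i $ j"
    using phi_positive[of j] by simp

  \<comment> \<open>Here \<open>?c\<close> is kept: the product is exactly the entry of
    \<open>Phat t\<close>, which is why the momenta are rescaled.\<close>
  have P: "P t $ i $ j * ?c = rho_inner D \<rho> ?Lv (\<phi> j)"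
    by (rule coefficient[OF int[OF L_partial_v_L2[OF t]] residual_p])
  have "P' $ i $ j * ?c = rho_inner D \<rho> (\<lambda>x. ?Lq x + ?F x) (\<phi> j)"
    using rho_integral_add(1)[OF int[OF L_partial_q_L2[OF t]] int[OF F_L2[OF t]]]
    by (intro coefficient[OF _ residual_F]) (simp_all add: distrib_right)
  also have "\<dots> = rho_inner D \<rho> ?Lq (\<phi> j) + rho_inner D \<rho> ?F (\<phi> j)"
    using rho_integral_add(2)[OF int[OF L_partial_q_L2[OF t]] int[OF F_L2[OF t]]]
    by (simp add: rho_inner_def distrib_right)
  finally have P'_eq: "P' $ i $ j * ?c = rho_inner D \<rho> ?Lq (\<phi> j) + Fhat (Q t) (V t) (u t) $ i $ j"
    by (simp add: Fhat_def gpc_force_def rho_inner_def q_def v_def)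

  note Lhat_q = partial_deriv_rho_integral_gpc_expand
    [where f = "\<lambda>a x. L a (v t x) x" and A = "Q t", OF regular_Q[OF t, of i j]]
  note Lhat_v = partial_deriv_rho_integral_gpc_expand
    [where f = "\<lambda>b x. L (q t x) b x" and A = "V t", OF regular_V[OF t, of i j]]
  have dv: "partially_differentiable (\<lambda>B. Lhat (Q t) B) (unit_mat i j) (V t)"
    "partial_deriv (\<lambda>B. Lhat (Q t) B) (unit_mat i j) (V t) = rho_inner D \<rho> ?Lv (\<phi> j)"
    using Lhat_v L_partial_v[OF t] by (simp_all add: Lhat_def gpc_lagrangian_def q_def v_def)
  have dq: "partially_differentiable (\<lambda>A. Lhat A (V t)) (unit_mat i j) (Q t)"
    "partial_deriv (\<lambda>A. Lhat A (V t)) (unit_mat i j) (Q t) = rho_inner D \<rho> ?Lq (\<phi> j)"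
    using Lhat_q L_partial_q[OF t] by (simp_all add: Lhat_def gpc_lagrangian_def q_def v_def)

  have Phat: "Phat s $ i $ j = P s $ i $ j * ?c" for s
    by (simp add: Phat_def gpc_momentum_def)
  \<comment> \<open>The factor \<open>?c\<close> does not depend on time, so it passes through the
    derivative and the projected force balance \<open>P'_eq\<close> applies.\<close>
  have "((\<lambda>s. Phat s $ i $ j) has_real_derivative P' $ i $ j * ?c) (at t within T)"
    unfolding Phat by (intro DERIV_cmult_right has_real_derivative_nth_nth[OF P'])
  then show "((\<lambda>s. Q s $ i $ j) has_real_derivative V t $ i $ j) (at t within T) \<and>
      partially_differentiable (\<lambda>B. Lhat (Q t) B) (unit_mat i j) (V t) \<and>
      Phat t $ i $ j = partial_deriv (\<lambda>B. Lhat (Q t) B) (unit_mat i j) (V t) \<and>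
      partially_differentiable (\<lambda>A. Lhat A (V t)) (unit_mat i j) (Q t) \<and>
      ((\<lambda>s. Phat s $ i $ j) has_real_derivative
         (partial_deriv (\<lambda>A. Lhat A (V t)) (unit_mat i j) (Q t)
          + Fhat (Q t) (V t) (u t) $ i $ j)) (at t within T)"
    using has_real_derivative_nth_nth[OF Q', of i j] dv dq P P'_eq V Phat by simp
qed

end
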